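(* Let $\theta_{\max}=\max_{e\in E(\Gamma)}\theta(e)$ and $0<\alpha<\pi/\theta_{\max}$. Let $\rho:V(\Gamma)\to[0,\infty)$ and let $f:C(\Gamma,\theta)\to C(\Gamma,\varphi)$ be the homogeneous harmonic map of degree $\alpha$ determined by $\rho$. Enumerate $V(\Gamma)=\{v_i\}$ and write $\rho_i=\rho(v_i)$, $\theta_{ij}=\theta(v_iv_j)$, $\varphi_{ij}=\varphi(v_iv_j)$. Then $f$ is balanced if and only if for each vertex $v_i$, $$\sum_{v_j\sim v_i}\frac{\cos(\varphi_{ij})\rho_j-\cos(\alpha\theta_{ij})\rho_i}{\sin(\alpha\theta_{ij})}=0.$$
   Context: $\Gamma$ is a finite connected simplicial graph (no loops or multiple edges) with at least one edge, vertex set $V(\Gamma)$, edge set $E(\Gamma)$; $v\sim w$ means adjacent. $\theta,\varphi:E(\Gamma)\to(0,\pi)$ are functions. $S_{\theta_0}=\{(r,\theta): r\ge 0,\ 0\le\theta\le\theta_0\}\subset\mathbb{R}^2$ is the plane sector in polar coordinates. The cone $C(\Gamma)=(\Gamma\times[0,\infty))/\!\sim$ collapses $\Gamma\times\{0\}$ to a point (its vertex). $C(\Gamma,\theta)$ is $C(\Gamma)$ with the metric for which each face $C(e)$ is isometric to $S_{\theta(e)}$: identifying $e$ with $[0,1]$, $(x,t)\in C(e)$ corresponds to polar coordinates $(t,x\theta(e))$; similarly for $C(\Gamma,\varphi)$. If $v$ is an endpoint of $e$, coordinates adapted to $v$ are those where $v$ corresponds to $0$, so $C(v)=\{v\}\times[0,\infty)$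 is the positive $x$-axis. A homogeneous map $f:C(\Gamma,\theta)\to C(\Gamma,\varphi)$ of degree $\alpha>0$ is a continuous map of the form $f(x,t)=(y(x),s(x)t^\alpha)$ with $y:\Gamma\to\Gamma$, $s:\Gamma\to[0,\infty)$. All such maps considered send each edge $C(v)$ into itself and each face $C(e)$ into itself. The map $f$ is harmonic if, for each face, its coordinate representation $S_{\theta(e)}\to S_{\varphi(e)}\subset\mathbb{R}^2$ has both rectangular components harmonic in the interior of the sector. It is balanced along $C(v)$ if $\sum_j\frac{\partial x_j}{\partial\theta}(r,0)=0$ for all $r>0$, where $e_j$ runs over edges incident to $v$ and $u_j=(x_j,y_j):S_{\theta(e_j)}\to S_{\varphi(e_j)}$ represents $f|_{C(e_j)}$ in coordinates adapted to $v$ in both domain (polar coordinates $(r,\theta)$) and target (rectangular coordinates). It is balanced if it is balanced along $C(v)$ for every $v\in V(\Gamma)$. For $0<\alpha<\pi/\theta_{\max}$, each $\rho:V(\Gamma)\to[0,\infty)$ determines a unique homogeneous harmonic map $f$ of degree $\alpha$ with $f(v,1)=(v,\rho(v))$ for all $v\in V(\Gamma)$; this is the map determined by $\rho$. *)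

theory Defs
  imports "HOL-Analysis.Analysis"
begin

definition simplicial_graph :: "'a set \<Rightarrow> 'a set set \<Rightarrow> bool" where
  "simplicial_graph V E \<longleftrightarrow> finite V \<and> (\<forall>e\<in>E. e \<subseteq> V \<and> card e = 2)"

definition connected_graph :: "'a set \<Rightarrow> 'a set set \<Rightarrow> bool" where
  "connected_graph V E \<longleftrightarrow> (\<forall>u\<in>V. \<forall>v\<in>V. (u, v) \<in> {(a, b). {a, b} \<in> E}\<^sup>*)"

text \<open>Points of the geometric realization are given by barycentric coordinates.  The union of the
  closed edges is all of the graph because the graphs considered here are connected with at least
  one edge, so they have no isolated vertices.\<close>

definition edge_points :: "'a set \<Rightarrow> ('a \<Rightarrow> real) set" where
  "edge_points e = {x. (\<forall>v. 0 \<le> x v) \<and> (\<forall>v. v \<notin> e \<longrightarrow> x v = 0) \<and> (\<Sum>v\<in>e. x v) = 1}"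

definition graph_points :: "'a set set \<Rightarrow> ('a \<Rightarrow> real) set" where
  "graph_points E = (\<Union>e\<in>E. edge_points e)"

definition vertex_point :: "'a \<Rightarrow> ('a \<Rightarrow> real)" where
  "vertex_point v = (\<lambda>u. if u = v then 1 else 0)"

type_synonym 'a cone_point = "(('a \<Rightarrow> real) \<times> real) set"

definition cone_rel :: "'a set set \<Rightarrow> ((('a \<Rightarrow> real) \<times> real) \<times> (('a \<Rightarrow> real) \<times> real)) set" where
  "cone_rel E = {(p, q). p \<in> graph_points E \<times> {0..} \<and> q \<in> graph_points E \<times> {0..}
     \<and> (p = q \<or> snd p = 0 \<and> snd q = 0)}"

definition graph_cone :: "'a set set \<Rightarrow> 'a cone_point set" where
  "graph_cone E = (graph_points E \<times> {0..}) // cone_rel E"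

definition cone_pt :: "'a set set \<Rightarrow> ('a \<Rightarrow> real) \<Rightarrow> real \<Rightarrow> 'a cone_point" where
  "cone_pt E x t = cone_rel E `` {(x, t)}"

definition cone_edge :: "'a set set \<Rightarrow> 'a \<Rightarrow> 'a cone_point set" where
  "cone_edge E v = {cone_pt E (vertex_point v) t |t. 0 \<le> t}"

definition cone_face :: "'a set set \<Rightarrow> 'a set \<Rightarrow> 'a cone_point set" where
  "cone_face E e = {cone_pt E x t |x t. x \<in> edge_points e \<and> 0 \<le> t}"

definition polar :: "real \<Rightarrow> real \<Rightarrow> real \<times> real" where
  "polar r a = (r * cos a, r * sin a)"

definition sector :: "real \<Rightarrow> (real \<times> real) set" where
  "sector a0 = {polar r a |r a. 0 \<le> r \<and> 0 \<le> a \<and> a \<le> a0}"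

text \<open>The coordinates of a point of the face spanned by \<open>v\<close> and \<open>w\<close>, adapted to \<open>v\<close>.  Identifying
  the edge with \<open>[0,1]\<close> so that \<open>v\<close> is \<open>0\<close> and \<open>w\<close> is \<open>1\<close>, the parameter of \<open>x\<close> is its barycentric
  coordinate \<open>x w\<close>.  All representatives of a cone point have the same coordinates (the apex goes
  to the origin), so the image of the equivalence class is a singleton.\<close>

definition face_chart :: "('a set \<Rightarrow> real) \<Rightarrow> 'a \<Rightarrow> 'a \<Rightarrow> 'a cone_point \<Rightarrow> real \<times> real" where
  "face_chart \<theta> v w p = the_elem ((\<lambda>(x, t). polar t (x w * \<theta> {v, w})) ` p)"

text \<open>The piecewise Euclidean metric: the infimum of the lengths of the chains in which consecutive
  points lie in a common face, each step being measured in the sector of that face.\<close>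

inductive cone_chain :: "'a set set \<Rightarrow> ('a set \<Rightarrow> real) \<Rightarrow> 'a cone_point \<Rightarrow> real \<Rightarrow> 'a cone_point \<Rightarrow> bool"
  for E \<theta> where
  nil: "cone_chain E \<theta> p 0 p"
| step: "\<lbrakk>{v, w} \<in> E; p \<in> cone_face E {v, w}; q \<in> cone_face E {v, w}; cone_chain E \<theta> q l r\<rbrakk>
    \<Longrightarrow> cone_chain E \<theta> p (dist (face_chart \<theta> v w p) (face_chart \<theta> v w q) + l) r"

definition cone_dist :: "'a set set \<Rightarrow> ('a set \<Rightarrow> real) \<Rightarrow> 'a cone_point \<Rightarrow> 'a cone_point \<Rightarrow> real" where
  "cone_dist E \<theta> p q =
     (if p \<in> graph_cone E \<and> q \<in> graph_cone E then Inf {l. cone_chain E \<theta> p l q} else 0)"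

definition cone_topology :: "'a set set \<Rightarrow> ('a set \<Rightarrow> real) \<Rightarrow> 'a cone_point topology" where
  "cone_topology E \<theta> = Metric_space.mtopology (graph_cone E) (cone_dist E \<theta>)"

definition homogeneous_map ::
  "'a set \<Rightarrow> 'a set set \<Rightarrow> ('a set \<Rightarrow> real) \<Rightarrow> ('a set \<Rightarrow> real) \<Rightarrow> real \<Rightarrow> ('a cone_point \<Rightarrow> 'a cone_point) \<Rightarrow> bool"
  where
  "homogeneous_map V E \<theta> \<phi> \<alpha> f \<longleftrightarrow>
     continuous_map (cone_topology E \<theta>) (cone_topology E \<phi>) f \<and>
     (\<exists>y s. (\<forall>x\<in>graph_points E. y x \<in> graph_points E \<and> 0 \<le> s x \<and>
        (\<forall>t\<ge>0. f (cone_pt E x t) = cone_pt E (y x) (s x * t powr \<alpha>)))) \<and>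
     (\<forall>v\<in>V. f ` cone_edge E v \<subseteq> cone_edge E v) \<and>
     (\<forall>e\<in>E. f ` cone_face E e \<subseteq> cone_face E e)"

text \<open>The map from the sector of angle \<open>\<theta> {v, w}\<close> to the sector of angle \<open>\<phi> {v, w}\<close> that represents
  the restriction of \<open>f\<close> to the face, in coordinates adapted to \<open>v\<close> on both sides.\<close>

definition coord_rep :: "'a set set \<Rightarrow> ('a set \<Rightarrow> real) \<Rightarrow> ('a set \<Rightarrow> real) \<Rightarrow> ('a cone_point \<Rightarrow> 'a cone_point)
    \<Rightarrow> 'a \<Rightarrow> 'a \<Rightarrow> real \<times> real \<Rightarrow> real \<times> real" where
  "coord_rep E \<theta> \<phi> f v w = face_chart \<phi> v w \<circ> f \<circ> inv_into (cone_face E {v, w}) (face_chart \<theta> v w)"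

text \<open>A function of class \<open>C\<^sup>2\<close> with vanishing Laplacian.\<close>

definition harmonic_on :: "(real \<times> real) set \<Rightarrow> (real \<times> real \<Rightarrow> real) \<Rightarrow> bool" where
  "harmonic_on U u \<longleftrightarrow> open U \<and>
     (\<exists>u1 u2 u11 u12 u21 u22.
        (\<forall>z\<in>U. (u has_derivative (\<lambda>(h, k). u1 z * h + u2 z * k)) (at z) \<and>
               (u1 has_derivative (\<lambda>(h, k). u11 z * h + u12 z * k)) (at z) \<and>
               (u2 has_derivative (\<lambda>(h, k). u21 z * h + u22 z * k)) (at z) \<and>
               u11 z + u22 z = 0) \<and>
        continuous_on U u11 \<and> continuous_on U u12 \<and> continuous_on U u21 \<and> continuous_on U u22)"

definition harmonic_map ::
  "'a set set \<Rightarrow> ('a set \<Rightarrow> real) \<Rightarrow> ('a set \<Rightarrow> real) \<Rightarrow> ('a cone_point \<Rightarrow> 'a cone_point) \<Rightarrow> bool" where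
  "harmonic_map E \<theta> \<phi> f \<longleftrightarrow> (\<forall>v w. {v, w} \<in> E \<longrightarrow>
     harmonic_on (interior (sector (\<theta> {v, w}))) (\<lambda>z. fst (coord_rep E \<theta> \<phi> f v w z)) \<and>
     harmonic_on (interior (sector (\<theta> {v, w}))) (\<lambda>z. snd (coord_rep E \<theta> \<phi> f v w z)))"

text \<open>The angular derivative at angle \<open>0\<close> is one-sided, since the representation only lives on the
  sector.\<close>

definition balanced_along ::
  "'a set set \<Rightarrow> ('a set \<Rightarrow> real) \<Rightarrow> ('a set \<Rightarrow> real) \<Rightarrow> ('a cone_point \<Rightarrow> 'a cone_point) \<Rightarrow> 'a \<Rightarrow> bool" where
  "balanced_along E \<theta> \<phi> f v \<longleftrightarrow> (\<forall>r>0. \<exists>D.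
     (\<forall>w. {v, w} \<in> E \<longrightarrow> ((\<lambda>a. fst (coord_rep E \<theta> \<phi> f v w (polar r a))) has_real_derivative D w)
        (at 0 within {0..\<theta> {v, w}})) \<and>
     (\<Sum>w | {v, w} \<in> E. D w) = 0)"

definition balanced ::
  "'a set \<Rightarrow> 'a set set \<Rightarrow> ('a set \<Rightarrow> real) \<Rightarrow> ('a set \<Rightarrow> real) \<Rightarrow> ('a cone_point \<Rightarrow> 'a cone_point) \<Rightarrow> bool" where
  "balanced V E \<theta> \<phi> f \<longleftrightarrow> (\<forall>v\<in>V. balanced_along E \<theta> \<phi> f v)"

definition determined_map :: "'a set \<Rightarrow> 'a set set \<Rightarrow> ('a set \<Rightarrow> real) \<Rightarrow> ('a set \<Rightarrow> real) \<Rightarrow> real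
    \<Rightarrow> ('a \<Rightarrow> real) \<Rightarrow> ('a cone_point \<Rightarrow> 'a cone_point) \<Rightarrow> bool" where
  "determined_map V E \<theta> \<phi> \<alpha> \<rho> f \<longleftrightarrow>
     homogeneous_map V E \<theta> \<phi> \<alpha> f \<and> harmonic_map E \<theta> \<phi> f \<and>
     (\<forall>v\<in>V. f (cone_pt E (vertex_point v) 1) = cone_pt E (vertex_point v) (\<rho> v))"

subsection \<open>The piecewise Euclidean metric is a metric\<close>

lemma cone_pt_pos: "x \<in> graph_points E \<Longrightarrow> 0 < t \<Longrightarrow> cone_pt E x t = {(x, t)}"
  by (auto simp: cone_pt_def cone_rel_def)

lemma cone_pt_zero: "x \<in> graph_points E \<Longrightarrow> cone_pt E x 0 = graph_points E \<times> {0}"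
  by (auto simp: cone_pt_def cone_rel_def)

lemma face_chart_cone_pt:
  assumes "x \<in> graph_points E" "0 \<le> t"
  shows "face_chart \<theta> v w (cone_pt E x t) = polar t (x w * \<theta> {v, w})"
proof (cases "t = 0")
  case True
  have "(\<lambda>(x, t). polar t (x w * \<theta> {v, w})) ` (graph_points E \<times> {0}) = {(0, 0)}"
    using assms(1) by (force simp: polar_def image_def)
  then show ?thesis using True assms by (simp add: face_chart_def cone_pt_zero polar_def)
next
  case False
  then show ?thesis using assms by (simp add: face_chart_def cone_pt_pos)
qed

lemma graph_cone_faces: "graph_cone E = (\<Union>e\<in>E. cone_face E e)"
  unfolding graph_cone_def cone_face_def quotient_def graph_points_def cone_pt_def by fast

lemma edge_points_in_graph: "x \<in> edge_points e \<Longrightarrow> e \<in> E \<Longrightarrow> x \<in> graph_points E"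
  by (auto simp: graph_points_def)

lemma edge_points_pair:
  assumes "v \<noteq> w"
  shows "x \<in> edge_points {v, w} \<longleftrightarrow> 0 \<le> x v \<and> 0 \<le> x w \<and> x v + x w = 1 \<and> (\<forall>u. u \<noteq> v \<longrightarrow> u \<noteq> w \<longrightarrow> x u = 0)"
  using assms by (auto simp: edge_points_def)

lemma cone_chain_append:
  "cone_chain E \<theta> p l q \<Longrightarrow> cone_chain E \<theta> q m r \<Longrightarrow> cone_chain E \<theta> p (l + m) r"
  by (induction rule: cone_chain.induct) (auto intro: cone_chain.intros simp: add.assoc)

lemma cone_chain_step:
  assumes "{v, w} \<in> E" "p \<in> cone_face E {v, w}" "q \<in> cone_face E {v, w}"
  shows "cone_chain E \<theta> p (dist (face_chart \<theta> v w p) (face_chart \<theta> v w q)) q"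
  using cone_chain.step[OF assms cone_chain.nil] by simp

lemma cone_chain_rev: "cone_chain E \<theta> p l q \<Longrightarrow> cone_chain E \<theta> q l p"
proof (induction rule: cone_chain.induct)
  case (step v w p q l r)
  show ?case
    using cone_chain_append[OF step.IH cone_chain_step[OF step(1) step(3) step(2)]]
    by (simp add: dist_commute add.commute)
qed (rule cone_chain.nil)

lemma cone_chain_nonneg: "cone_chain E \<theta> p l q \<Longrightarrow> 0 \<le> l"
  by (induction rule: cone_chain.induct) auto

lemma cone_chain_exists:
  assumes E: "\<forall>e\<in>E. card e = 2" and "p \<in> graph_cone E" "q \<in> graph_cone E"
  shows "\<exists>l. cone_chain E \<theta> p l q"
proof -
  have apex: "\<exists>l. cone_chain E \<theta> p l (graph_points E \<times> {0})" if "p \<in> graph_cone E" for p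
  proof -
    obtain e where e: "e \<in> E" "p \<in> cone_face E e" using \<open>p \<in> graph_cone E\<close> by (auto simp: graph_cone_faces)
    obtain v w where vw: "e = {v, w}" using E e(1) by (meson card_2_iff)
    obtain x where "x \<in> edge_points e" using e(2) by (auto simp: cone_face_def)
    then have "cone_pt E x 0 \<in> cone_face E e" "cone_pt E x 0 = graph_points E \<times> {0}"
      using cone_pt_zero[of x E] edge_points_in_graph[of x e E] e(1) unfolding cone_face_def by blast+
    then have "graph_points E \<times> {0} \<in> cone_face E e" by simp
    from cone_chain_step[OF e(1)[unfolded vw] e(2)[unfolded vw] this[unfolded vw]]
    show ?thesis by blast
  qed
  obtain l m where "cone_chain E \<theta> p l (graph_points E \<times> {0})" "cone_chain E \<theta> q m (graph_points E \<times> {0})"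
    using apex assms(2,3) by blast
  then show ?thesis using cone_chain_append cone_chain_rev by blast
qed

text \<open>Coordinates of a point of a face with respect to the basis given by the two boundary rays.\<close>

definition lin_param where
  "lin_param \<theta> w x = (if x w = 0 then 0 else if x w = (1::real) then 1
     else sin (x w * \<theta> {u. x u \<noteq> 0}) / sin (\<theta> {u. x u \<noteq> (0::real)}) :: real)"

definition lin_coord where
  "lin_coord \<theta> w p = the_elem ((\<lambda>(x, t). t * lin_param \<theta> w x) ` p)"

lemma lin_coord_cone_pt:
  assumes "x \<in> graph_points E" "0 \<le> t"
  shows "lin_coord \<theta> w (cone_pt E x t) = t * lin_param \<theta> w x"
proof (cases "t = 0")
  case True
  have "(\<lambda>(x, t). t * lin_param \<theta> w x) ` (graph_points E \<times> {0}) = {0}"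
    using assms(1) by (force simp: image_def)
  then show ?thesis using True assms by (simp add: lin_coord_def cone_pt_zero)
next
  case False
  then show ?thesis using assms by (simp add: lin_coord_def cone_pt_pos)
qed

lemma lin_param_edge:
  assumes "v \<noteq> w" "x \<in> edge_points {v, w}" "0 < \<theta> {v, w}" "\<theta> {v, w} < pi"
  shows "lin_param \<theta> w x = sin (x w * \<theta> {v, w}) / sin (\<theta> {v, w})"
proof -
  have s: "sin (\<theta> {v, w}) > 0" using assms sin_gt_zero by blast
  have *: "0 \<le> x v" "0 \<le> x w" "x v + x w = 1" "\<And>u. u \<noteq> v \<Longrightarrow> u \<noteq> w \<Longrightarrow> x u = 0"
    using assms by (auto simp: edge_points_pair)
  have "{u. x u \<noteq> 0} = {v, w}" if "x w \<noteq> 0" "x w \<noteq> 1" using that * by fastforce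
  then show ?thesis using s by (auto simp: lin_param_def)
qed

context
  fixes E :: "'a set set" and \<theta> :: "'a set \<Rightarrow> real"
  assumes finE: "finite E" and E2: "\<forall>e\<in>E. card e = 2" and \<theta>: "\<forall>e\<in>E. 0 < \<theta> e \<and> \<theta> e < pi"
begin

lemma edge_neq: "{v, w} \<in> E \<Longrightarrow> v \<noteq> w"
  using E2 by force

lemma sin_pos: "e \<in> E \<Longrightarrow> 0 < sin (\<theta> e)"
  using \<theta> sin_gt_zero by blast

lemma lin_coord_chart:
  assumes "{v, w} \<in> E" "p \<in> cone_face E {v, w}"
  shows "lin_coord \<theta> w p = snd (face_chart \<theta> v w p) / sin (\<theta> {v, w})"
proof -
  obtain x t where x: "p = cone_pt E x t" "x \<in> edge_points {v, w}" "0 \<le> t"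
    using assms(2) by (auto simp: cone_face_def)
  show ?thesis
    using x edge_points_in_graph[OF x(2) assms(1)] lin_param_edge[where \<theta>=\<theta>, OF edge_neq[OF assms(1)] x(2)] \<theta> assms(1)
    by (simp add: lin_coord_cone_pt face_chart_cone_pt polar_def)
qed

lemma chart_flip:
  assumes "{v, w} \<in> E" "p \<in> cone_face E {v, w}"
  shows "face_chart \<theta> w v p =
    (cos (\<theta> {v, w}) * fst (face_chart \<theta> v w p) + sin (\<theta> {v, w}) * snd (face_chart \<theta> v w p),
     sin (\<theta> {v, w}) * fst (face_chart \<theta> v w p) - cos (\<theta> {v, w}) * snd (face_chart \<theta> v w p))"
proof -
  obtain x t where x: "p = cone_pt E x t" "x \<in> edge_points {v, w}" "0 \<le> t"
    using assms(2) by (auto simp: cone_face_def)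
  have "x v = 1 - x w" using x(2) edge_points_pair[OF edge_neq[OF assms(1)], of x] by simp
  then have a: "x v * \<theta> {w, v} = \<theta> {v, w} - x w * \<theta> {v, w}"
    by (simp add: insert_commute left_diff_distrib)
  show ?thesis
    using x edge_points_in_graph[OF x(2) assms(1)]
    by (simp add: face_chart_cone_pt polar_def a cos_diff sin_diff algebra_simps)
qed

lemma dist_chart_flip:
  assumes "{v, w} \<in> E" "p \<in> cone_face E {v, w}" "q \<in> cone_face E {v, w}"
  shows "dist (face_chart \<theta> w v p) (face_chart \<theta> w v q) = dist (face_chart \<theta> v w p) (face_chart \<theta> v w q)"
proof -
  have "(c * a + s * b - (c * a' + s * b'))\<^sup>2 + (s * a - c * b - (s * a' - c * b'))\<^sup>2
     = (s\<^sup>2 + c\<^sup>2) * ((a - a')\<^sup>2 + (b - b')\<^sup>2)" for a b a' b' s c :: real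
    by algebra
  then show ?thesis
    by (simp add: chart_flip[OF assms(1,2)] chart_flip[OF assms(1,3)] dist_prod_def dist_real_def)
qed

lemma lin_coord_other:
  assumes "{v, w} \<in> E" "p \<in> cone_face E {v, w}" "u \<noteq> v" "u \<noteq> w"
  shows "lin_coord \<theta> u p = 0"
proof -
  obtain x t where x: "p = cone_pt E x t" "x \<in> edge_points {v, w}" "0 \<le> t"
    using assms(2) by (auto simp: cone_face_def)
  have "x u = 0" using x(2) assms by (simp add: edge_points_def)
  then show ?thesis
    using x edge_points_in_graph[OF x(2) assms(1)] by (simp add: lin_coord_cone_pt lin_param_def)
qed

definition cone_lip where "cone_lip = (\<Sum>e\<in>E. 1 / sin (\<theta> e))"

lemma cone_lip_ge: "e \<in> E \<Longrightarrow> 1 / sin (\<theta> e) \<le> cone_lip"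
  unfolding cone_lip_def by (rule member_le_sum) (use finE sin_pos less_imp_le in auto)

lemma cone_lip_nonneg: "0 \<le> cone_lip"
  unfolding cone_lip_def by (rule sum_nonneg) (use sin_pos less_imp_le in auto)

lemma lin_coord_step:
  assumes e: "{v, w} \<in> E" "p \<in> cone_face E {v, w}" "q \<in> cone_face E {v, w}"
  shows "\<bar>lin_coord \<theta> u p - lin_coord \<theta> u q\<bar> \<le> cone_lip * dist (face_chart \<theta> v w p) (face_chart \<theta> v w q)"
proof -
  have main: "\<bar>lin_coord \<theta> w p - lin_coord \<theta> w q\<bar> \<le> cone_lip * dist (face_chart \<theta> v w p) (face_chart \<theta> v w q)"
    if e: "{v, w} \<in> E" "p \<in> cone_face E {v, w}" "q \<in> cone_face E {v, w}" for v w
  proof -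
    have "\<bar>lin_coord \<theta> w p - lin_coord \<theta> w q\<bar>
        = 1 / sin (\<theta> {v, w}) * dist (snd (face_chart \<theta> v w p)) (snd (face_chart \<theta> v w q))"
      using sin_pos[OF e(1)]
      by (simp add: lin_coord_chart[OF e(1,2)] lin_coord_chart[OF e(1,3)] dist_real_def flip: diff_divide_distrib)
    also have "\<dots> \<le> cone_lip * dist (face_chart \<theta> v w p) (face_chart \<theta> v w q)"
      by (intro mult_mono cone_lip_ge e dist_snd_le cone_lip_nonneg) auto
    finally show ?thesis .
  qed
  consider "u = w" | "u = v" | "u \<noteq> v" "u \<noteq> w" by blast
  then show ?thesis
  proof cases
    case 1
    then show ?thesis using main[OF e] by simp
  next
    case 2
    then show ?thesis using main[of w v] e dist_chart_flip[OF e] by (simp add: insert_commute)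
  next
    case 3
    then show ?thesis using lin_coord_other e cone_lip_nonneg by simp
  qed
qed

lemma lin_coord_chain:
  "cone_chain E \<theta> p l q \<Longrightarrow> \<bar>lin_coord \<theta> u p - lin_coord \<theta> u q\<bar> \<le> cone_lip * l"
proof (induction rule: cone_chain.induct)
  case (step v w p q l r)
  then show ?case using lin_coord_step[OF step(1-3), of u] by (simp add: distrib_left)
qed simp

lemma cone_dist_greatest:
  assumes "p \<in> graph_cone E" "q \<in> graph_cone E" "\<And>l. cone_chain E \<theta> p l q \<Longrightarrow> b \<le> l"
  shows "b \<le> cone_dist E \<theta> p q"
  using assms cone_chain_exists[OF E2 assms(1,2), of \<theta>] unfolding cone_dist_def
  by (auto intro!: cInf_greatest)

lemma lin_coord_dist:
  assumes "p \<in> graph_cone E" "q \<in> graph_cone E"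
  shows "\<bar>lin_coord \<theta> u p - lin_coord \<theta> u q\<bar> \<le> cone_lip * cone_dist E \<theta> p q"
proof -
  obtain l where l: "cone_chain E \<theta> p l q" using cone_chain_exists[OF E2 assms] by blast
  show ?thesis
  proof (cases "cone_lip = 0")
    case True
    then show ?thesis using lin_coord_chain[OF l, of u] by simp
  next
    case False
    then have pos: "0 < cone_lip" using cone_lip_nonneg by simp
    have "\<bar>lin_coord \<theta> u p - lin_coord \<theta> u q\<bar> / cone_lip \<le> cone_dist E \<theta> p q"
      using lin_coord_chain[of p _ q u] pos
      by (intro cone_dist_greatest assms) (simp add: divide_le_eq mult.commute)
    then show ?thesis using pos by (simp add: divide_le_eq mult.commute)
  qed
qed

lemma face_chart_inj:
  assumes e: "{v, w} \<in> E"
  shows "inj_on (face_chart \<theta> v w) (cone_face E {v, w})"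
proof (rule inj_onI)
  fix p q assume p: "p \<in> cone_face E {v, w}" and q: "q \<in> cone_face E {v, w}"
    and eq: "face_chart \<theta> v w p = face_chart \<theta> v w q"
  have nvw: "v \<noteq> w" using edge_neq e .
  have th: "0 < \<theta> {v, w}" "\<theta> {v, w} < pi" using \<theta> e by auto
  obtain x t where x: "p = cone_pt E x t" "x \<in> edge_points {v, w}" "0 \<le> t"
    using p by (auto simp: cone_face_def)
  obtain y s where y: "q = cone_pt E y s" "y \<in> edge_points {v, w}" "0 \<le> s"
    using q by (auto simp: cone_face_def)
  note xG = edge_points_in_graph[OF x(2) e] and yG = edge_points_in_graph[OF y(2) e]
  have P: "polar t (x w * \<theta> {v, w}) = polar s (y w * \<theta> {v, w})"
    using eq x y xG yG by (simp add: face_chart_cone_pt)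
  have norm: "norm (polar r a) = \<bar>r\<bar>" for r a
  proof -
    have "(r * cos a)\<^sup>2 + (r * sin a)\<^sup>2 = r\<^sup>2 * ((sin a)\<^sup>2 + (cos a)\<^sup>2)"
      by algebra
    then have "(r * cos a)\<^sup>2 + (r * sin a)\<^sup>2 = r\<^sup>2" by simp
    then show ?thesis by (simp add: polar_def norm_prod_def)
  qed
  have ts: "t = s" using norm[of t "x w * \<theta> {v, w}"] norm[of s "y w * \<theta> {v, w}"] x(3) y(3) P by simp
  show "p = q"
  proof (cases "t = 0")
    case True
    then show ?thesis using ts x y xG yG by (simp add: cone_pt_zero)
  next
    case False
    have bx: "0 \<le> x w" "x w \<le> 1" "x v = 1 - x w" and by': "0 \<le> y w" "y w \<le> 1" "y v = 1 - y w"
      using x(2) y(2) by (auto simp: edge_points_pair[OF nvw])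
    have "cos (x w * \<theta> {v, w}) = cos (y w * \<theta> {v, w})" using P ts False by (simp add: polar_def)
    moreover have "x w * \<theta> {v, w} \<le> pi" "y w * \<theta> {v, w} \<le> pi"
      using bx by' th mult_left_le_one_le[of "\<theta> {v, w}" "x w"] mult_left_le_one_le[of "\<theta> {v, w}" "y w"]
      by linarith+
    ultimately have "x w * \<theta> {v, w} = y w * \<theta> {v, w}"
      using bx by' th cos_inj_pi[of "x w * \<theta> {v, w}" "y w * \<theta> {v, w}"] by simp
    then have "x w = y w" using th by simp
    moreover have "x u = 0" "y u = 0" if "u \<notin> {v, w}" for u
      using that x(2) y(2) unfolding edge_points_def by blast+
    ultimately have "x u = y u" for u
      using bx(3) by'(3) by (metis insert_iff singletonD)
    then have "x = y" by (rule ext)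
    then show ?thesis using ts x y by simp
  qed
qed

lemma face_chart_eqI:
  assumes e: "{v, w} \<in> E" and p: "p \<in> cone_face E {v, w}" and q: "q \<in> cone_face E {v, w}"
    and eq: "\<And>u. lin_coord \<theta> u p = lin_coord \<theta> u q"
  shows "p = q"
proof -
  have s: "0 < sin (\<theta> {v, w})" using sin_pos e .
  have e': "{w, v} \<in> E" "p \<in> cone_face E {w, v}" "q \<in> cone_face E {w, v}" "sin (\<theta> {w, v}) \<noteq> 0"
    using e p q s by (simp_all add: insert_commute)
  have 1: "snd (face_chart \<theta> v w p) = snd (face_chart \<theta> v w q)"
    using eq[of w] s lin_coord_chart[OF e p] lin_coord_chart[OF e q] by simp
  have "snd (face_chart \<theta> w v p) = snd (face_chart \<theta> w v q)"
    using eq[of v] e'(4) lin_coord_chart[OF e'(1,2)] lin_coord_chart[OF e'(1,3)] by simp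
  then have "fst (face_chart \<theta> v w p) = fst (face_chart \<theta> v w q)"
    using 1 s chart_flip[OF e p] chart_flip[OF e q] by simp
  with 1 have "face_chart \<theta> v w p = face_chart \<theta> v w q" by (simp add: prod_eq_iff)
  then show ?thesis using face_chart_inj[OF e] p q by (simp add: inj_on_def)
qed

lemma lin_nonzero_iff:
  assumes "x \<in> graph_points E"
  shows "lin_param \<theta> u x \<noteq> 0 \<longleftrightarrow> x u \<noteq> 0"
proof
  assume "lin_param \<theta> u x \<noteq> 0" then show "x u \<noteq> 0" by (auto simp: lin_param_def)
next
  assume u: "x u \<noteq> 0"
  obtain e where e: "e \<in> E" "x \<in> edge_points e" using assms by (auto simp: graph_points_def)
  have ue: "u \<in> e" using u e by (auto simp: edge_points_def)
  then obtain v where v: "e = {v, u}" using E2 e(1) by (metis card_2_iff doubleton_eq_iff insert_iff singletonD)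
  have nvu: "v \<noteq> u" using edge_neq e(1) v by blast
  have b: "0 < x u" "x u \<le> 1" using u e(2) unfolding v edge_points_pair[OF nvu] by auto
  have th: "0 < \<theta> e" "\<theta> e < pi" using \<theta> e by auto
  have "0 < x u * \<theta> e" "x u * \<theta> e < pi"
    using b th mult_left_le_one_le[of "\<theta> e" "x u"] by (simp, linarith)
  then have "0 < sin (x u * \<theta> e)" by (rule sin_gt_zero)
  then show "lin_param \<theta> u x \<noteq> 0"
    using lin_param_edge[where \<theta>=\<theta>, OF nvu] e(2) th sin_pos[OF e(1)] unfolding v by simp
qed

lemma lin_coord_separates:
  assumes p: "p \<in> graph_cone E" and q: "q \<in> graph_cone E"
    and eq: "\<And>u. lin_coord \<theta> u p = lin_coord \<theta> u q"
  shows "p = q"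
proof -
  obtain e x t where x: "e \<in> E" "x \<in> edge_points e" "0 \<le> t" "p = cone_pt E x t"
    using p by (auto simp: graph_cone_faces cone_face_def)
  obtain e' y s where y: "e' \<in> E" "y \<in> edge_points e'" "0 \<le> s" "q = cone_pt E y s"
    using q by (auto simp: graph_cone_faces cone_face_def)
  note xG = edge_points_in_graph[OF x(2,1)] and yG = edge_points_in_graph[OF y(2,1)]
  have eq': "t * lin_param \<theta> u x = s * lin_param \<theta> u y" for u
    using eq[of u] x y xG yG by (simp add: lin_coord_cone_pt)
  have ex: "\<exists>u. z u \<noteq> 0" if "z \<in> graph_points E" for z
  proof (rule ccontr)
    assume "\<not> ?thesis"
    then show False using that by (auto simp: graph_points_def edge_points_def)
  qed
  have iff: "t \<noteq> 0 \<and> x u \<noteq> 0 \<longleftrightarrow> s \<noteq> 0 \<and> y u \<noteq> 0" for u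
    using eq'[of u] lin_nonzero_iff[OF xG, of u] lin_nonzero_iff[OF yG, of u] by (metis mult_eq_0_iff)
  have t0: "t = 0 \<longleftrightarrow> s = 0" using iff ex[OF xG] ex[OF yG] by blast
  show ?thesis
  proof (cases "t = 0")
    case True
    then show ?thesis using t0 x y xG yG by (simp add: cone_pt_zero)
  next
    case False
    have sup: "x u \<noteq> 0 \<longleftrightarrow> y u \<noteq> 0" for u using iff[of u] False t0 by blast
    have fin: "finite e" "finite e'" using E2 x(1) y(1) by (auto intro: card_ge_0_finite)
    have y0: "y u = 0" if "u \<notin> e" for u using sup[of u] that x(2) by (auto simp: edge_points_def)
    have "(\<Sum>u\<in>e. y u) = (\<Sum>u\<in>e'. y u)"
      using fin y0 y(2) by (intro sum.mono_neutral_cong) (auto simp: edge_points_def)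
    then have ye: "y \<in> edge_points e" using y(2) y0 by (auto simp: edge_points_def)
    obtain v w where vw: "e = {v, w}" using E2 x(1) by (meson card_2_iff)
    have "p \<in> cone_face E e" "q \<in> cone_face E e" using x y ye by (auto simp: cone_face_def)
    then show ?thesis using face_chart_eqI eq x(1) unfolding vw by blast
  qed
qed

lemma cone_dist_le:
  assumes "p \<in> graph_cone E" "q \<in> graph_cone E" "cone_chain E \<theta> p l q"
  shows "cone_dist E \<theta> p q \<le> l"
  using assms unfolding cone_dist_def by (auto intro!: cInf_lower bdd_belowI[of _ 0] cone_chain_nonneg)

lemma Metric_space_cone: "Metric_space (graph_cone E) (cone_dist E \<theta>)"
proof
  show nonneg: "0 \<le> cone_dist E \<theta> p q" for p q
  proof (cases "p \<in> graph_cone E \<and> q \<in> graph_cone E")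
    case True
    then show ?thesis by (auto intro: cone_dist_greatest cone_chain_nonneg)
  qed (auto simp: cone_dist_def)
  show comm: "cone_dist E \<theta> p q = cone_dist E \<theta> q p" for p q
  proof -
    have "{l. cone_chain E \<theta> p l q} = {l. cone_chain E \<theta> q l p}" by (auto intro: cone_chain_rev)
    then show ?thesis by (simp add: cone_dist_def)
  qed
  show "(cone_dist E \<theta> p q = 0) = (p = q)" if "p \<in> graph_cone E" "q \<in> graph_cone E" for p q
  proof
    assume "cone_dist E \<theta> p q = 0"
    then show "p = q" using lin_coord_dist[OF that] lin_coord_separates[OF that] by force
  next
    assume "p = q"
    then have "cone_dist E \<theta> p q \<le> 0" using cone_dist_le[OF that] cone_chain.nil by blast
    moreover have "0 \<le> cone_dist E \<theta> p q" by (rule nonneg)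
    ultimately show "cone_dist E \<theta> p q = 0" by simp
  qed
  show "cone_dist E \<theta> p r \<le> cone_dist E \<theta> p q + cone_dist E \<theta> q r"
    if "p \<in> graph_cone E" "q \<in> graph_cone E" "r \<in> graph_cone E" for p q r
  proof -
    have "cone_dist E \<theta> p r - l \<le> cone_dist E \<theta> q r" if l: "cone_chain E \<theta> p l q" for l
    proof (rule cone_dist_greatest)
      fix m assume "cone_chain E \<theta> q m r"
      then show "cone_dist E \<theta> p r - l \<le> m"
        using cone_dist_le[OF \<open>p \<in> _\<close> \<open>r \<in> _\<close> cone_chain_append[OF l]] by fastforce
    qed fact+
    then have "cone_dist E \<theta> p r - cone_dist E \<theta> q r \<le> cone_dist E \<theta> p q"
      by (intro cone_dist_greatest that) (auto simp: algebra_simps)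
    then show ?thesis by simp
  qed
qed

end

lemma Metric_space_graph_cone:
  assumes "simplicial_graph V E" "\<forall>e\<in>E. 0 < \<theta> e \<and> \<theta> e < pi"
  shows "Metric_space (graph_cone E) (cone_dist E \<theta>)"
proof (rule Metric_space_cone)
  have "E \<subseteq> Pow V" "finite V" using assms(1) by (auto simp: simplicial_graph_def)
  then show "finite E" using finite_subset by blast
  show "\<forall>e\<in>E. card e = 2" using assms(1) by (simp add: simplicial_graph_def)
qed (rule assms(2))

end

theory Submission
  imports Defs
begin

text \<open>By homogeneity the representation of \<open>f\<close> on a face is \<open>r\<^sup>\<alpha> h(a)\<close> in polar coordinates, and
  harmonicity becomes \<open>h'' + \<alpha>\<^sup>2 h = 0\<close> in each component.  As \<open>\<alpha>\<theta> < \<pi>\<close>, the first component is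
  determined by its values at the two ends of the face, namely \<open>\<rho>(v)\<close> and \<open>cos \<phi> \<rho>(w)\<close> in coordinates
  adapted to \<open>v\<close>; its angular derivative at \<open>0\<close> is \<open>\<alpha> r\<^sup>\<alpha>\<close> times the summand in the balancing
  formula.\<close>

section \<open>Homogeneous harmonic functions on a sector\<close>

lemma DERIV_compose_pair:
  fixes g :: "real \<times> real \<Rightarrow> real"
  assumes "(g has_derivative (\<lambda>(h, k). g1 * h + g2 * k)) (at (X t, Y t))"
    and "(X has_real_derivative X') (at t)" "(Y has_real_derivative Y') (at t)"
  shows "((\<lambda>t. g (X t, Y t)) has_real_derivative g1 * X' + g2 * Y') (at t)"
proof -
  have "((\<lambda>t. (X t, Y t)) has_derivative (\<lambda>d. (X' * d, Y' * d))) (at t)"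
    using assms(2,3) by (intro has_derivative_Pair) (auto simp: has_field_derivative_def)
  from has_derivative_compose[OF this assms(1)] show ?thesis
    unfolding has_field_derivative_def by (rule back_subst[of "\<lambda>D. (_ has_derivative D) _"]) (auto simp: algebra_simps)
qed

text \<open>The open witness \<open>?S\<close> is the intersection of two half-planes, bounded by
  the lines through the two sides of the sector. At \<open>polar r a\<close> the two defining
  expressions are r sin a and r sin(\<theta> - a), both positive; conversely, their positivity keeps
  the angle of a point of \<open>?S\<close> below \<theta>.\<close>

lemma polar_in_interior_sector:
  assumes "0 < r" "0 < a" "a < \<theta>" "\<theta> < pi"
  shows "polar r a \<in> interior (sector \<theta>)"
proof (rule interiorI)
  let ?S = "{z::real \<times> real. 0 < snd z} \<inter> {z. 0 < fst z * sin \<theta> - snd z * cos \<theta>}"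
  show "open ?S"
    by (intro open_Int open_Collect_less continuous_intros)
  have "0 < sin a" "0 < sin (\<theta> - a)" using assms by (auto intro: sin_gt_zero)
  then show "polar r a \<in> ?S"
    using assms by (simp add: polar_def sin_diff algebra_simps flip: right_diff_distrib)
  show "?S \<subseteq> sector \<theta>"
  proof
    fix z assume z: "z \<in> ?S"
    obtain x y where xy: "z = (x, y)" by (cases z)
    have y: "0 < y" and p: "0 < x * sin \<theta> - y * cos \<theta>" using z xy by auto
    \<comment> \<open>As y > 0, the polar angle of (x, y) is arccos(x / R).\<close>
    define R where "R = sqrt (x\<^sup>2 + y\<^sup>2)"
    have R: "0 < R" "R\<^sup>2 = x\<^sup>2 + y\<^sup>2" using y by (simp_all add: R_def sum_power2_gt_zero_iff)
    have "\<bar>x\<bar> \<le> R" by (simp add: R_def)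
    then have b: "-1 \<le> x / R" "x / R \<le> 1" using R by (auto simp: field_simps)
    have cs: "cos (arccos (x / R)) = x / R" using b by simp
    have "(R * sin (arccos (x / R)))\<^sup>2 = R\<^sup>2 - (R * (x / R))\<^sup>2"
      unfolding power_mult_distrib sin_squared_eq cs by (simp add: right_diff_distrib)
    also have "\<dots> = y\<^sup>2" using R by simp
    finally have sn: "R * sin (arccos (x / R)) = y"
      using y R(1) sin_ge_zero[OF arccos_lbound[OF b] arccos_ubound[OF b]]
      by (simp add: power2_eq_iff_nonneg)
    have zp: "z = polar R (arccos (x / R))" using R(1) cs sn by (simp add: xy polar_def)
    have "x * sin \<theta> - y * cos \<theta> = R * cos (arccos (x / R)) * sin \<theta> - R * sin (arccos (x / R)) * cos \<theta>"
      using zp xy by (simp add: polar_def)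
    also have "\<dots> = R * sin (\<theta> - arccos (x / R))"
      by (simp add: sin_diff algebra_simps)
    finally have pos: "0 < sin (\<theta> - arccos (x / R))" using p R(1) by (simp add: zero_less_mult_iff)
    \<comment> \<open>Otherwise the excess over \<theta> would lie between 0 and pi, which gives the
      sine in \<open>pos\<close> the wrong sign.\<close>
    have "arccos (x / R) \<le> \<theta>"
    proof (rule ccontr)
      assume "\<not> ?thesis"
      then have "0 \<le> sin (arccos (x / R) - \<theta>)"
        using assms arccos_ubound[OF b] by (intro sin_ge_zero) auto
      moreover have "sin (arccos (x / R) - \<theta>) = - sin (\<theta> - arccos (x / R))"
        by (metis minus_diff_eq sin_minus)
      ultimately show False using pos by simp
    qed
    then show "z \<in> sector \<theta>"
      using zp R(1) arccos_lbound[OF b] less_imp_le unfolding sector_def by blast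
  qed
qed

text \<open>This is the polar Laplace equation u_rr + u_r / r + u_aa / r^2 = 0 at r = 1, where
  homogeneity gives u_r = \<alpha> h and u_rr = \<alpha> (\<alpha> - 1) h, leaving h'' = -\<alpha>^2
  h.\<close>

lemma harmonic_homogeneous_ODE:
  assumes harm: "harmonic_on (interior (sector \<theta>)) u" and th: "\<theta> < pi"
    and hom: "\<And>r a. \<lbrakk>0 < r; 0 < a; a < \<theta>\<rbrakk> \<Longrightarrow> u (polar r a) = r powr \<alpha> * h a"
  obtains h' where "\<And>a. \<lbrakk>0 < a; a < \<theta>\<rbrakk> \<Longrightarrow> (h has_real_derivative h' a) (at a)"
    and "\<And>a. \<lbrakk>0 < a; a < \<theta>\<rbrakk> \<Longrightarrow> (h' has_real_derivative - \<alpha>\<^sup>2 * h a) (at a)"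
proof -
  obtain u1 u2 u11 u12 u21 u22 where D: "\<And>z. z \<in> interior (sector \<theta>) \<Longrightarrow>
       (u has_derivative (\<lambda>(h, k). u1 z * h + u2 z * k)) (at z) \<and>
       (u1 has_derivative (\<lambda>(h, k). u11 z * h + u12 z * k)) (at z) \<and>
       (u2 has_derivative (\<lambda>(h, k). u21 z * h + u22 z * k)) (at z) \<and> u11 z + u22 z = 0"
    using harm unfolding harmonic_on_def by blast
  have P: "(r * cos a, r * sin a) \<in> interior (sector \<theta>)" if "0 < r" "0 < a" "a < \<theta>" for r a
    using polar_in_interior_sector[OF that th] by (simp add: polar_def)
  note chain_u = DERIV_compose_pair[OF conjunct1[OF D]]
  note chain_u1 = DERIV_compose_pair[OF conjunct1[OF conjunct2[OF D]]]
  note chain_u2 = DERIV_compose_pair[OF conjunct1[OF conjunct2[OF conjunct2[OF D]]]]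
  define h' where "h' = (\<lambda>a. - u1 (cos a, sin a) * sin a + u2 (cos a, sin a) * cos a)"
  have h': "(h has_real_derivative h' a) (at a)" if a: "0 < a" "a < \<theta>" for a
  proof -
    have "((\<lambda>t. u (cos t, sin t)) has_real_derivative
        u1 (cos a, sin a) * (- sin a) + u2 (cos a, sin a) * cos a) (at a)"
      using P[of 1 a] a by (intro chain_u) (auto intro!: derivative_eq_intros)
    then have "((\<lambda>t. u (cos t, sin t)) has_real_derivative h' a) (at a)" by (simp add: h'_def)
    then show ?thesis
    proof (rule has_field_derivative_transform_within_open[of _ _ _ "{0<..<\<theta>}"])
      show "u (cos t, sin t) = h t" if "t \<in> {0<..<\<theta>}" for t
        using hom[of 1 t] that by (simp add: polar_def)
    qed (use a in auto)
  qed
  \<comment> \<open>The radial derivative is computed twice, by the chain rule and from the power of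
    r. It is stated for every r > 0 because it is differentiated in r once more below.\<close>
  have radial: "u1 (r * cos a, r * sin a) * cos a + u2 (r * cos a, r * sin a) * sin a
      = \<alpha> * r powr (\<alpha> - 1) * h a" if ra: "0 < r" "0 < a" "a < \<theta>" for r a
  proof -
    have "((\<lambda>t. u (t * cos a, t * sin a)) has_real_derivative
       u1 (r * cos a, r * sin a) * cos a + u2 (r * cos a, r * sin a) * sin a) (at r)"
      using P[OF ra] by (intro chain_u) (auto intro!: derivative_eq_intros)
    moreover have "((\<lambda>t. u (t * cos a, t * sin a)) has_real_derivative \<alpha> * r powr (\<alpha> - 1) * h a) (at r)"
    proof (rule has_field_derivative_transform_within_open[of _ _ _ "{0<..}"])
      show "((\<lambda>t. t powr \<alpha> * h a) has_real_derivative \<alpha> * r powr (\<alpha> - 1) * h a) (at r)"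
        using ra by (auto intro!: derivative_eq_intros)
      show "t powr \<alpha> * h a = u (t * cos a, t * sin a)" if "t \<in> {0<..}" for t
        using hom[of t a] that ra by (simp add: polar_def)
    qed (use ra in auto)
    ultimately show ?thesis by (rule DERIV_unique)
  qed
  have h'': "(h' has_real_derivative - \<alpha>\<^sup>2 * h a) (at a)" if a: "0 < a" "a < \<theta>" for a
  proof -
    define c s where "c = cos a" and "s = sin a"
    have cs: "s\<^sup>2 + c\<^sup>2 = 1" by (simp add: c_def s_def)
    have z: "(1 * cos a, 1 * sin a) \<in> interior (sector \<theta>)" by (intro P a) simp
    have "((\<lambda>t. u1 (t * cos a, t * sin a) * cos a + u2 (t * cos a, t * sin a) * sin a) has_real_derivative
       (u11 (1 * cos a, 1 * sin a) * cos a + u12 (1 * cos a, 1 * sin a) * sin a) * cos a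
        + (u21 (1 * cos a, 1 * sin a) * cos a + u22 (1 * cos a, 1 * sin a) * sin a) * sin a) (at 1)"
      using z by (intro DERIV_add DERIV_cmult_right chain_u1 chain_u2) (auto intro!: derivative_eq_intros)
    moreover have "((\<lambda>t. u1 (t * cos a, t * sin a) * cos a + u2 (t * cos a, t * sin a) * sin a)
       has_real_derivative \<alpha> * (\<alpha> - 1) * h a) (at 1)"
    proof (rule has_field_derivative_transform_within_open[of _ _ _ "{0<..}"])
      show "((\<lambda>t. \<alpha> * t powr (\<alpha> - 1) * h a) has_real_derivative \<alpha> * (\<alpha> - 1) * h a) (at 1)"
        by (auto intro!: derivative_eq_intros)
      show "\<alpha> * t powr (\<alpha> - 1) * h a = u1 (t * cos a, t * sin a) * cos a + u2 (t * cos a, t * sin a) * sin a"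
        if "t \<in> {0<..}" for t
        using radial[of t a] that a by simp
    qed auto
    ultimately have rr: "(u11 (c, s) * c + u12 (c, s) * s) * c + (u21 (c, s) * c + u22 (c, s) * s) * s
        = \<alpha> * (\<alpha> - 1) * h a"
      using DERIV_unique unfolding c_def s_def by fastforce
    have r: "u1 (c, s) * c + u2 (c, s) * s = \<alpha> * h a" using radial[of 1 a] a by (simp add: c_def s_def)
    have lap: "u11 (c, s) + u22 (c, s) = 0" using D[OF z] by (simp add: c_def s_def)
    have "(h' has_real_derivative
        - ((u11 (c, s) * (- s) + u12 (c, s) * c) * s + u1 (c, s) * c)
        + ((u21 (c, s) * (- s) + u22 (c, s) * c) * c - u2 (c, s) * s)) (at a)"
    proof -
      have 1: "((\<lambda>t. u1 (cos t, sin t)) has_real_derivative u11 (c, s) * (- s) + u12 (c, s) * c) (at a)"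
        using z unfolding c_def s_def by (intro chain_u1) (auto intro!: derivative_eq_intros)
      have 2: "((\<lambda>t. u2 (cos t, sin t)) has_real_derivative u21 (c, s) * (- s) + u22 (c, s) * c) (at a)"
        using z unfolding c_def s_def by (intro chain_u2) (auto intro!: derivative_eq_intros)
      show ?thesis unfolding h'_def
        by (rule derivative_eq_intros 1 2 refl)+ (simp add: c_def s_def algebra_simps)
    qed
    \<comment> \<open>The second derivatives of \<open>u\<close> in the radial and the tangential
      direction add up to the Laplacian, which vanishes by \<open>lap\<close>; the mixed terms
      cancel in that sum. The terms with \<open>u1\<close> and \<open>u2\<close> arise because the
      tangent direction turns with the angle, and \<open>r\<close> evaluates them.\<close>
    moreover have "- ((u11 (c, s) * (- s) + u12 (c, s) * c) * s + u1 (c, s) * c)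
        + ((u21 (c, s) * (- s) + u22 (c, s) * c) * c - u2 (c, s) * s) = - \<alpha>\<^sup>2 * h a"
      using rr r lap cs by algebra
    ultimately show ?thesis by simp
  qed
  from h' h'' show thesis by (rule that)
qed

text \<open>By the equation the vector (h, h' / \<alpha>) rotates with constant angular speed.
  Undoing the rotation gives two combinations with zero derivative, whose values are A and B. The
  equation is given only inside the interval; continuity carries the formula to both ends, where
  boundary values will be read off.\<close>

lemma harmonic_oscillator_solution:
  fixes h :: "real \<Rightarrow> real"
  assumes "\<alpha> \<noteq> 0" "0 < \<theta>" and cont: "continuous_on {0..\<theta>} h"
    and h': "\<And>a. \<lbrakk>0 < a; a < \<theta>\<rbrakk> \<Longrightarrow> (h has_real_derivative h' a) (at a)"
    and h'': "\<And>a. \<lbrakk>0 < a; a < \<theta>\<rbrakk> \<Longrightarrow> (h' has_real_derivative - \<alpha>\<^sup>2 * h a) (at a)"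
  obtains A B where "\<And>a. a \<in> {0..\<theta>} \<Longrightarrow> h a = A * cos (\<alpha> * a) + B * sin (\<alpha> * a)"
proof -
  have "\<exists>A. \<forall>a\<in>{0<..<\<theta>}. h a * cos (\<alpha> * a) - h' a / \<alpha> * sin (\<alpha> * a) = A"
  proof (rule has_field_derivative_zero_constant)
    fix a assume "a \<in> {0<..<\<theta>}"
    then have a: "0 < a" "a < \<theta>" by auto
    have "((\<lambda>a. h a * cos (\<alpha> * a) - h' a / \<alpha> * sin (\<alpha> * a)) has_real_derivative 0) (at a)"
      using assms(1)
      by (auto intro!: derivative_eq_intros h'[OF a] h''[OF a] simp: field_simps power2_eq_square)
    then show "((\<lambda>a. h a * cos (\<alpha> * a) - h' a / \<alpha> * sin (\<alpha> * a)) has_real_derivative 0) (at a within {0<..<\<theta>})"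
      by (rule has_field_derivative_at_within)
  qed simp
  then obtain A where A: "\<And>a. a \<in> {0<..<\<theta>} \<Longrightarrow> h a * cos (\<alpha> * a) - h' a / \<alpha> * sin (\<alpha> * a) = A" by blast
  have "\<exists>B. \<forall>a\<in>{0<..<\<theta>}. h a * sin (\<alpha> * a) + h' a / \<alpha> * cos (\<alpha> * a) = B"
  proof (rule has_field_derivative_zero_constant)
    fix a assume "a \<in> {0<..<\<theta>}"
    then have a: "0 < a" "a < \<theta>" by auto
    have "((\<lambda>a. h a * sin (\<alpha> * a) + h' a / \<alpha> * cos (\<alpha> * a)) has_real_derivative 0) (at a)"
      using assms(1)
      by (auto intro!: derivative_eq_intros h'[OF a] h''[OF a] simp: field_simps power2_eq_square)
    then show "((\<lambda>a. h a * sin (\<alpha> * a) + h' a / \<alpha> * cos (\<alpha> * a)) has_real_derivative 0) (at a within {0<..<\<theta>})"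
      by (rule has_field_derivative_at_within)
  qed simp
  then obtain B where B: "\<And>a. a \<in> {0<..<\<theta>} \<Longrightarrow> h a * sin (\<alpha> * a) + h' a / \<alpha> * cos (\<alpha> * a) = B" by blast
  have eq: "h a = A * cos (\<alpha> * a) + B * sin (\<alpha> * a)" if "a \<in> {0<..<\<theta>}" for a
  proof -
    have "(H * c - g * s) * c + (H * s + g * c) * s = H * (s\<^sup>2 + c\<^sup>2)" for H g s c :: real
      by algebra
    from this[of "h a" "cos (\<alpha> * a)" "h' a / \<alpha>" "sin (\<alpha> * a)"]
    show ?thesis using A[OF that] B[OF that] by simp
  qed
  have "h a - (A * cos (\<alpha> * a) + B * sin (\<alpha> * a)) = 0" if "a \<in> {0..\<theta>}" for a
  proof (rule continuous_constant_on_closure[of "{0<..<\<theta>}" "\<lambda>a. h a - (A * cos (\<alpha> * a) + B * sin (\<alpha> * a))"])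
    show "continuous_on (closure {0<..<\<theta>}) (\<lambda>a. h a - (A * cos (\<alpha> * a) + B * sin (\<alpha> * a)))"
      using assms(2) by (auto intro!: continuous_intros cont)
  qed (use that assms(2) eq in auto)
  then show thesis by (intro that) simp
qed

section \<open>Points of a face and continuity in the cone metric\<close>

definition edge_pt :: "'a \<Rightarrow> 'a \<Rightarrow> real \<Rightarrow> ('a \<Rightarrow> real)" where
  "edge_pt v w s = (\<lambda>u. if u = v then 1 - s else if u = w then s else 0)"

lemma edge_pt_in_edge_points: "\<lbrakk>v \<noteq> w; 0 \<le> s; s \<le> 1\<rbrakk> \<Longrightarrow> edge_pt v w s \<in> edge_points {v, w}"
  by (simp add: edge_points_pair edge_pt_def)

lemma edge_pt_0: "v \<noteq> w \<Longrightarrow> edge_pt v w 0 = vertex_point v"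
  and edge_pt_1: "v \<noteq> w \<Longrightarrow> edge_pt v w 1 = vertex_point w"
  by (auto simp: edge_pt_def vertex_point_def)

context
  fixes E :: "'a set set" and \<theta> :: "'a set \<Rightarrow> real"
  assumes finE: "finite E" and E2: "\<forall>e\<in>E. card e = 2" and \<theta>: "\<forall>e\<in>E. 0 < \<theta> e \<and> \<theta> e < pi"
begin

text \<open>By \<open>lin_coord_dist\<close> the coordinate is Lipschitz for
  \<open>cone_dist\<close>, although that distance is an infimum over chains that may leave a face.
  It turns continuity of a map into the cone into continuity of real functions.\<close>

lemma continuous_map_lin_coord: "continuous_map (cone_topology E \<theta>) euclideanreal (lin_coord \<theta> u)"
proof -
  interpret Metric_space "graph_cone E" "cone_dist E \<theta>"
    by (rule Metric_space_cone[OF finE E2 \<theta>])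
  let ?L = "cone_lip E \<theta>"
  have "Lipschitz_continuous_map (metric (graph_cone E, cone_dist E \<theta>)) euclidean_metric (lin_coord \<theta> u)"
    unfolding Lipschitz_continuous_map_def
    using lin_coord_dist[OF finE E2 \<theta>]
    by (auto simp: dist_real_def intro!: exI[of _ ?L])
  from Lipschitz_continuous_imp_continuous_map[OF this] show ?thesis
    by (simp add: cone_topology_def mtopology_of_def)
qed

text \<open>In the chart, a point of the face is a combination of the unit vectors (1, 0) and (cos
  \<theta>, sin \<theta>) along the two sides, with the \<open>lin_coord\<close> values as
  coefficients. So the first component is expressed through functions continuous on the whole
  cone.\<close>

lemma fst_face_chart:
  assumes "{v, w} \<in> E" "p \<in> cone_face E {v, w}"
  shows "fst (face_chart \<theta> v w p) = lin_coord \<theta> v p + cos (\<theta> {v, w}) * lin_coord \<theta> w p"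
proof -
  have "{w, v} \<in> E" "p \<in> cone_face E {w, v}" using assms by (simp_all add: insert_commute)
  then have "lin_coord \<theta> v p = snd (face_chart \<theta> w v p) / sin (\<theta> {v, w})"
    using lin_coord_chart[OF finE E2 \<theta>, of w v p] by (simp add: insert_commute)
  then show ?thesis
    using sin_pos[OF finE E2 \<theta> assms(1)]
    by (simp add: chart_flip[OF finE E2 \<theta> assms] lin_coord_chart[OF finE E2 \<theta> assms] field_simps)
qed

text \<open>The chart shows this curve as an arc of the unit circle, parametrised by angle. A
  one-step chain joins any two of its points, so \<open>cone_dist\<close> is at most their Euclidean
  distance in the chart, and continuity of \<open>polar 1\<close> gives the claim.\<close>

lemma continuous_map_arc:
  assumes e: "{v, w} \<in> E"
  shows "continuous_map (top_of_set {0..\<theta> {v, w}}) (cone_topology E \<theta>)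
    (\<lambda>a. cone_pt E (edge_pt v w (a / \<theta> {v, w})) 1)"
proof -
  interpret Metric_space "graph_cone E" "cone_dist E \<theta>"
    by (rule Metric_space_cone[OF finE E2 \<theta>])
  let ?t = "\<theta> {v, w}" and ?g = "\<lambda>a. cone_pt E (edge_pt v w (a / \<theta> {v, w})) 1"
  have t: "0 < ?t" using \<theta> e by auto
  have face: "?g a \<in> cone_face E {v, w}" if "a \<in> {0..?t}" for a
    using edge_pt_in_edge_points[OF edge_neq[OF finE E2 \<theta> e], of "a / ?t"] that t
    by (auto simp: cone_face_def intro!: exI[of _ 1] exI[of _ "edge_pt v w (a / ?t)"])
  have cone: "?g a \<in> graph_cone E" if "a \<in> {0..?t}" for a
    using face[OF that] e by (auto simp: graph_cone_faces)
  have chart: "face_chart \<theta> v w (?g a) = polar 1 a" if "a \<in> {0..?t}" for a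
    using edge_points_in_graph[OF edge_pt_in_edge_points[OF edge_neq[OF finE E2 \<theta> e], of "a / ?t"] e]
      that t edge_neq[OF finE E2 \<theta> e]
    by (simp add: face_chart_cone_pt edge_pt_def)
  have near: "\<exists>d>0. \<forall>b\<in>{0..?t}. dist b a < d \<longrightarrow> cone_dist E \<theta> (?g a) (?g b) < \<epsilon>"
    if a: "a \<in> {0..?t}" and \<epsilon>: "0 < \<epsilon>" for a \<epsilon>
  proof -
    have "continuous_on UNIV (polar 1)" unfolding polar_def by (intro continuous_intros)
    then have "\<exists>d>0. \<forall>b\<in>UNIV. dist b a < d \<longrightarrow> dist (polar 1 b) (polar 1 a) < \<epsilon>"
      using \<epsilon> unfolding continuous_on_iff by blast
    then obtain d where d: "0 < d" "\<And>b. dist b a < d \<Longrightarrow> dist (polar 1 b) (polar 1 a) < \<epsilon>" by blast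
    have "cone_dist E \<theta> (?g a) (?g b) \<le> dist (polar 1 b) (polar 1 a)" if b: "b \<in> {0..?t}" for b
      using cone_dist_le[OF finE E2 \<theta> cone[OF a] cone[OF b]
          cone_chain_step[where \<theta>=\<theta>, OF e face[OF a] face[OF b]]]
      unfolding chart[OF a] chart[OF b] by (simp add: dist_commute)
    then show ?thesis using d by (meson le_less_trans)
  qed
  show ?thesis
    unfolding cone_topology_def continuous_map_to_metric
  proof (intro ballI allI impI)
    fix a and \<epsilon> :: real assume "a \<in> topspace (top_of_set {0..?t})" and \<epsilon>: "0 < \<epsilon>"
    then have a: "a \<in> {0..?t}" by simp
    obtain d where d: "0 < d" "\<And>b. b \<in> {0..?t} \<Longrightarrow> dist b a < d \<Longrightarrow> cone_dist E \<theta> (?g a) (?g b) < \<epsilon>"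
      using near[OF a \<epsilon>] by blast
    show "\<exists>U. openin (top_of_set {0..?t}) U \<and> a \<in> U \<and> (\<forall>b\<in>U. ?g b \<in> mball (?g a) \<epsilon>)"
      using d a cone
      by (intro exI[of _ "{0..?t} \<inter> ball a d"]) (auto simp: openin_open_Int in_mball dist_commute)
  qed
qed

end

section \<open>The map on one face and the balancing condition\<close>

lemma determined_map_face:
  assumes finE: "finite E" and E2: "\<forall>e\<in>E. card e = 2"
    and \<theta>: "\<forall>e\<in>E. 0 < \<theta> e \<and> \<theta> e < pi" and \<phi>: "\<forall>e\<in>E. 0 < \<phi> e \<and> \<phi> e < pi"
    and \<alpha>: "0 < \<alpha>" "\<alpha> * \<theta> {v, w} < pi"
    and f: "determined_map V E \<theta> \<phi> \<alpha> \<rho> f" and e: "{v, w} \<in> E" and vw: "v \<in> V" "w \<in> V"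
    and \<rho>: "0 \<le> \<rho> v" "0 \<le> \<rho> w"
    and r: "0 < r" and a: "a \<in> {0..\<theta> {v, w}}"
  shows "fst (coord_rep E \<theta> \<phi> f v w (polar r a)) = r powr \<alpha> * (\<rho> v * cos (\<alpha> * a)
    + (cos (\<phi> {v, w}) * \<rho> w - cos (\<alpha> * \<theta> {v, w}) * \<rho> v) / sin (\<alpha> * \<theta> {v, w}) * sin (\<alpha> * a))"
proof -
  let ?t = "\<theta> {v, w}" and ?p = "\<phi> {v, w}"
  \<comment> \<open>Dividing by the angle of the face converts the angle a into the edge
    parameter.\<close>
  let ?x = "\<lambda>a. edge_pt v w (a / \<theta> {v, w})"
  have nvw: "v \<noteq> w" using edge_neq[OF finE E2 \<theta> e] .
  have t: "0 < ?t" "?t < pi" using \<theta> e by auto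
  obtain y s where ys: "\<forall>x\<in>graph_points E. y x \<in> graph_points E \<and> 0 \<le> s x \<and>
        (\<forall>t\<ge>0. f (cone_pt E x t) = cone_pt E (y x) (s x * t powr \<alpha>))"
    using f unfolding determined_map_def homogeneous_map_def by (elim conjE exE)
  have cf: "continuous_map (cone_topology E \<theta>) (cone_topology E \<phi>) f"
    and ff: "f ` cone_face E {v, w} \<subseteq> cone_face E {v, w}"
    and fv: "f (cone_pt E (vertex_point v) 1) = cone_pt E (vertex_point v) (\<rho> v)"
      "f (cone_pt E (vertex_point w) 1) = cone_pt E (vertex_point w) (\<rho> w)"
    and harm: "harmonic_on (interior (sector ?t)) (\<lambda>z. fst (coord_rep E \<theta> \<phi> f v w z))"
    using f e vw unfolding determined_map_def homogeneous_map_def harmonic_map_def by auto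
  have xE: "?x a \<in> edge_points {v, w}" if "a \<in> {0..?t}" for a
    using edge_pt_in_edge_points[OF nvw, of "a / ?t"] that t by auto
  have xG: "?x a \<in> graph_points E" if "a \<in> {0..?t}" for a
    using edge_points_in_graph[OF xE[OF that] e] .
  have face: "cone_pt E (?x a) r \<in> cone_face E {v, w}" if "a \<in> {0..?t}" "0 \<le> r" for a r
    using xE that by (auto simp: cone_face_def)
  have chart: "face_chart \<theta> v w (cone_pt E (?x a) r) = polar r a" if "a \<in> {0..?t}" "0 \<le> r" for a r
    using xG[OF that(1)] that t nvw by (simp add: face_chart_cone_pt edge_pt_def)
  \<comment> \<open>The chart is injective on the face, so its inverse sends
    \<open>polar r a\<close> back to the cone point over \<open>?x a\<close> at distance r.\<close>
  have rep: "coord_rep E \<theta> \<phi> f v w (polar r a) = face_chart \<phi> v w (f (cone_pt E (?x a) r))"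
    if "a \<in> {0..?t}" "0 \<le> r" for a r
    using inv_into_f_f[OF face_chart_inj[OF finE E2 \<theta> e] face[OF that]]
    by (simp add: coord_rep_def chart[OF that])
  define h where "h = (\<lambda>a. fst (face_chart \<phi> v w (f (cone_pt E (?x a) 1))))"
  \<comment> \<open>The edge point given by \<open>y\<close> depends on a but not on r; only the
    distance from the apex changes with r, and the chart is proportional to it.\<close>
  have hom: "fst (coord_rep E \<theta> \<phi> f v w (polar r a)) = r powr \<alpha> * h a"
    if "a \<in> {0..?t}" "0 < r" for a r
    using bspec[OF ys xG[OF that(1)]] that
    by (simp add: rep[OF that(1)] h_def face_chart_cone_pt) (simp add: polar_def)
  \<comment> \<open>Continuity up to both ends is what lets the boundary values fix the solution. It
    comes from composing the arc, \<open>f\<close> and the coordinates of the target cone.\<close>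
  have cont: "continuous_on {0..?t} h"
  proof -
    have g: "continuous_map (top_of_set {0..?t}) (cone_topology E \<phi>) (\<lambda>a. f (cone_pt E (?x a) 1))"
      using continuous_map_compose[OF continuous_map_arc[OF finE E2 \<theta> e] cf] by (simp add: comp_def)
    have "continuous_on {0..?t} (\<lambda>a. lin_coord \<phi> u (f (cone_pt E (?x a) 1)))" for u
      using continuous_map_compose[OF g continuous_map_lin_coord[OF finE E2 \<phi>]] by (simp add: comp_def)
    then have "continuous_on {0..?t} (\<lambda>a. lin_coord \<phi> v (f (cone_pt E (?x a) 1))
       + cos ?p * lin_coord \<phi> w (f (cone_pt E (?x a) 1)))"
      by (intro continuous_intros)
    then show ?thesis
    proof (rule continuous_on_eq)
      fix a assume "a \<in> {0..?t}"
      then show "lin_coord \<phi> v (f (cone_pt E (?x a) 1)) + cos ?p * lin_coord \<phi> w (f (cone_pt E (?x a) 1)) = h a"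
        using ff face[of a 1] unfolding h_def
        by (subst fst_face_chart[OF finE E2 \<phi> e]) auto
    qed
  qed
  obtain h' where h': "\<And>a. \<lbrakk>0 < a; a < ?t\<rbrakk> \<Longrightarrow> (h has_real_derivative h' a) (at a)"
    "\<And>a. \<lbrakk>0 < a; a < ?t\<rbrakk> \<Longrightarrow> (h' has_real_derivative - \<alpha>\<^sup>2 * h a) (at a)"
    by (rule harmonic_homogeneous_ODE[OF harm t(2), of \<alpha> h]) (auto intro: hom)
  obtain A B where AB: "\<And>a. a \<in> {0..?t} \<Longrightarrow> h a = A * cos (\<alpha> * a) + B * sin (\<alpha> * a)"
    by (rule harmonic_oscillator_solution[OF less_imp_neq[OF \<alpha>(1), symmetric] t(1) cont h']) auto
  have "h 0 = \<rho> v"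
    using xG[of 0] t \<rho> nvw
    by (simp add: h_def edge_pt_0 fv face_chart_cone_pt)
      (simp add: polar_def vertex_point_def)
  then have A: "A = \<rho> v" using AB[of 0] t by simp
  \<comment> \<open>In the target chart adapted to v, the vertex w lies on the side at angle
    \<open>?p\<close>, hence the factor cos.\<close>
  have "h ?t = cos ?p * \<rho> w"
    using xG[of ?t] t \<rho> nvw
    by (simp add: h_def edge_pt_1 fv face_chart_cone_pt)
      (simp add: polar_def vertex_point_def)
  \<comment> \<open>Since \<alpha> \<theta> < pi, the sine at the far end is nonzero, so the value
    there determines B.\<close>
  moreover have "0 < sin (\<alpha> * ?t)" using \<alpha> t by (intro sin_gt_zero) auto
  ultimately have "B = (cos ?p * \<rho> w - cos (\<alpha> * ?t) * \<rho> v) / sin (\<alpha> * ?t)"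
    using AB[of ?t] t A by (simp add: field_simps)
  then show ?thesis using hom[OF a r] AB[OF a] A by simp
qed

theorem theorem5p1:
  fixes V :: "'a set" and E :: "'a set set" and \<theta> \<phi> :: "'a set \<Rightarrow> real"
    and \<alpha> :: real and \<rho> :: "'a \<Rightarrow> real" and f :: "'a cone_point \<Rightarrow> 'a cone_point"
  assumes "simplicial_graph V E" and "connected_graph V E" and "E \<noteq> {}"
    and "\<forall>e\<in>E. 0 < \<theta> e \<and> \<theta> e < pi" and "\<forall>e\<in>E. 0 < \<phi> e \<and> \<phi> e < pi"
    and "0 < \<alpha>" and "\<alpha> < pi / Max (\<theta> ` E)"
    and "\<forall>v\<in>V. 0 \<le> \<rho> v"
    and "determined_map V E \<theta> \<phi> \<alpha> \<rho> f"
  shows "balanced V E \<theta> \<phi> f \<longleftrightarrow>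
    (\<forall>v\<in>V. (\<Sum>w | {v, w} \<in> E.
       (cos (\<phi> {v, w}) * \<rho> w - cos (\<alpha> * \<theta> {v, w}) * \<rho> v) / sin (\<alpha> * \<theta> {v, w})) = 0)"
proof -
  have sub: "E \<subseteq> Pow V" and E2: "\<forall>e\<in>E. card e = 2" and "finite V"
    using assms(1) by (auto simp: simplicial_graph_def)
  then have finE: "finite E" using finite_subset by blast
  have \<alpha>\<theta>: "\<alpha> * \<theta> e < pi" if "e \<in> E" for e
  proof -
    have "\<theta> e \<le> Max (\<theta> ` E)" "0 < \<theta> e" using finE that assms(4) by auto
    then have "\<alpha> * \<theta> e \<le> \<alpha> * Max (\<theta> ` E)" "\<alpha> * Max (\<theta> ` E) < pi"
      using assms(6,7) by (auto simp: field_simps)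
    then show ?thesis by simp
  qed
  define B where "B v w = (cos (\<phi> {v, w}) * \<rho> w - cos (\<alpha> * \<theta> {v, w}) * \<rho> v) / sin (\<alpha> * \<theta> {v, w})" for v w
  \<comment> \<open>At angle 0 the cosine term has derivative zero and the sine term contributes
    \<alpha> \<open>B v w\<close>.\<close>
  have deriv: "((\<lambda>a. fst (coord_rep E \<theta> \<phi> f v w (polar r a))) has_real_derivative r powr \<alpha> * \<alpha> * B v w)
      (at 0 within {0..\<theta> {v, w}})" if e: "{v, w} \<in> E" and r: "0 < r" for v w r
  proof (rule has_field_derivative_transform_within[where d=1])
    show "((\<lambda>a. r powr \<alpha> * (\<rho> v * cos (\<alpha> * a) + B v w * sin (\<alpha> * a))) has_real_derivative r powr \<alpha> * \<alpha> * B v w)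
      (at 0 within {0..\<theta> {v, w}})"
      by (auto intro!: derivative_eq_intros)
    show "0 \<in> {0..\<theta> {v, w}}" using assms(4) e less_imp_le by auto
    show "r powr \<alpha> * (\<rho> v * cos (\<alpha> * a) + B v w * sin (\<alpha> * a)) = fst (coord_rep E \<theta> \<phi> f v w (polar r a))"
      if "a \<in> {0..\<theta> {v, w}}" for a
      unfolding B_def
      using determined_map_face[OF finE E2 assms(4,5,6) \<alpha>\<theta>[OF e] assms(9) e _ _ _ _ r that] sub e assms(8)
      by auto
  qed simp
  \<comment> \<open>The interval has positive length, so the one-sided derivative at its end is
    unique; this forces the values D in \<open>balanced_along\<close>.\<close>
  have uniq: "D = D'" if "(g has_real_derivative D) (at 0 within {0..\<theta> e})"
    "(g has_real_derivative D') (at 0 within {0..\<theta> e})" "e \<in> E" for g D D' e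
    using that assms(4) less_imp_le
    by (intro vector_derivative_unique_within_closed_interval[of 0 "\<theta> e" 0 g])
      (auto simp: has_real_derivative_iff_has_vector_derivative)
  have "balanced_along E \<theta> \<phi> f v \<longleftrightarrow> (\<Sum>w | {v, w} \<in> E. B v w) = 0" for v
  proof
    assume "balanced_along E \<theta> \<phi> f v"
    \<comment> \<open>Radius 1 suffices: the radius enters only through the factor
      \<open>r powr \<alpha>\<close>, which is 1 there.\<close>
    then obtain D where D: "\<And>w. {v, w} \<in> E \<Longrightarrow> ((\<lambda>a. fst (coord_rep E \<theta> \<phi> f v w (polar 1 a)))
        has_real_derivative D w) (at 0 within {0..\<theta> {v, w}})" "(\<Sum>w | {v, w} \<in> E. D w) = 0"
      unfolding balanced_along_def by (elim allE[of _ 1] impE[OF _ zero_less_one] exE conjE) blast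
    have "D w = \<alpha> * B v w" if "{v, w} \<in> E" for w
      using uniq[OF D(1)[OF that] deriv[OF that]] that by simp
    then have "\<alpha> * (\<Sum>w | {v, w} \<in> E. B v w) = 0" using D(2) by (simp add: sum_distrib_left)
    then show "(\<Sum>w | {v, w} \<in> E. B v w) = 0" using assms(6) by simp
  next
    assume *: "(\<Sum>w | {v, w} \<in> E. B v w) = 0"
    show "balanced_along E \<theta> \<phi> f v" unfolding balanced_along_def
    proof (intro allI impI exI conjI)
      fix r :: real assume r: "0 < r"
      \<comment> \<open>This fixes the witness for D. Its factor
        \<open>r powr \<alpha> * \<alpha>\<close> is the same for all neighbours w, so the vanishing
        of the sum passes to every radius.\<close>
      show "((\<lambda>a. fst (coord_rep E \<theta> \<phi> f v w (polar r a))) has_real_derivative r powr \<alpha> * \<alpha> * B v w)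
        (at 0 within {0..\<theta> {v, w}})" if "{v, w} \<in> E" for w using deriv[OF that r] .
      show "(\<Sum>w | {v, w} \<in> E. r powr \<alpha> * \<alpha> * B v w) = 0"
        using * by (simp flip: sum_distrib_left)
    qed
  qed
  then show ?thesis by (simp add: balanced_def B_def)
qed

end
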